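(* Let $\mathcal{S}$ and $\mathcal{B}$ be algebras over a field $\mathbb{F}$ with $\operatorname{char}(\mathbb{F})=0$, and let $\mathcal{A}=\mathcal{S}\otimes\mathcal{B}$. Suppose that $\mathcal{S}$ is simple, and suppose that $\mathcal{B}$ satisfies: (a) every element in $\mathcal{B}$ is a sum of commutators; and (b) for each $n\ge 1$, every element in $\mathcal{B}$ is a linear combination of elements $b^n$, $b\in\mathcal{B}$. If $f\in\mathbb{F}\langle\bar X\rangle$ is neither an identity nor a central polynomial of $\mathcal{S}$, then $\operatorname{span} f(\mathcal{A})=\mathcal{A}$.
   Context: $\mathbb{F}\langle\bar X\rangle$ denotes the free algebra over the field $\mathbb{F}$ generated by $\bar X=\{X_1,X_2,\ldots\}$, i.e. the algebra of all noncommutative polynomials in the $X_i$. Algebras are associative, and the tensor product is over $\mathbb{F}$. A commutator is an element of the form $[u,v]=uv-vu$. For an $\mathbb{F}$-algebra $\mathcal{R}$ and $f=f(X_1,\ldots,X_n)\in\mathbb{F}\langle\bar X\rangle$, $f(\mathcal{R})$ denotes the set of all values $f(a_1,\ldots,a_n)$ with $a_i\in\mathcal{R}$, $i=1,\ldots,n$, and $\operatorname{span} f(\mathcal{R})$ denotes the $\mathbb{F}$-linear span of $f(\mathcal{R})$. The polynomial $f$ is an identity of $\mathcal{R}$ if $f(\mathcal{R})=\{0\}$; it is a central polynomial of $\mathcal{R}$ if $f(\mathcal{R})$ is contained in the center of $\mathcal{R}$ but $f$ is not an identity of $\mathcal{R}$. An algebra is simple (in the usual sense) if its multiplication is nonzero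 and it has no two-sided ideals other than $0$ and itself. *)

theory Defs
  imports Complex_Main "HOL-Library.Poly_Mapping"
begin

section \<open>Algebras over a field\<close>

text \<open>
  An algebra over the field \<open>'f\<close> is a type of class \<^class>\<open>ring\<close>, which is associative but need
  neither be commutative nor have a unity, with a compatible scalar multiplication.
\<close>

locale assoc_algebra = vector_space scale
  for scale :: "'f::field \<Rightarrow> 'a::ring \<Rightarrow> 'a" +
  assumes scale_mult_left: "scale c x * y = scale c (x * y)"
    and scale_mult_right: "x * scale c y = scale c (x * y)"

abbreviation lspan :: "('f::field \<Rightarrow> 'a::ab_group_add \<Rightarrow> 'a) \<Rightarrow> 'a set \<Rightarrow> 'a set" where
  "lspan \<equiv> module.span"

definition two_sided_ideal :: "('f::field \<Rightarrow> 'a::ring \<Rightarrow> 'a) \<Rightarrow> 'a set \<Rightarrow> bool" where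
  "two_sided_ideal scale I \<longleftrightarrow>
     module.subspace scale I \<and> (\<forall>x\<in>I. \<forall>r. r * x \<in> I \<and> x * r \<in> I)"

definition simple_algebra :: "('f::field \<Rightarrow> 'a::ring \<Rightarrow> 'a) \<Rightarrow> bool" where
  "simple_algebra scale \<longleftrightarrow>
     (\<exists>x y :: 'a. x * y \<noteq> 0) \<and> (\<forall>I. two_sided_ideal scale I \<longrightarrow> I = {0} \<or> I = UNIV)"

definition center :: "'a::ring set" where
  "center = {z. \<forall>x. z * x = x * z}"

definition commutator :: "'a::ring \<Rightarrow> 'a \<Rightarrow> 'a" where
  "commutator u v = u * v - v * u"

definition is_unity :: "'a::ring \<Rightarrow> bool" where
  "is_unity e \<longleftrightarrow> (\<forall>x. e * x = x \<and> x * e = x)"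

text \<open>
  The library's \<^const>\<open>prod_list\<close> and powers require a unity.  The product of the empty list below
  is only meaningful if the algebra has a unity.
\<close>

fun mult_list :: "'a::ring list \<Rightarrow> 'a" where
  "mult_list [] = (THE e. is_unity e)"
| "mult_list [x] = x"
| "mult_list (x # y # ys) = x * mult_list (y # ys)"

definition power_of :: "'a::ring \<Rightarrow> nat \<Rightarrow> 'a" where
  "power_of x n = mult_list (replicate n x)"


section \<open>Noncommutative polynomials\<close>

text \<open>
  An element of the free algebra is a finitely supported function from words in the variables
  (the variables being indexed by \<^typ>\<open>nat\<close>) to coefficients; the empty word carries the
  constant term.
\<close>

type_synonym 'f nc_poly = "nat list \<Rightarrow>\<^sub>0 'f"

definition nc_eval :: "('f::field \<Rightarrow> 'a::ring \<Rightarrow> 'a) \<Rightarrow> 'f nc_poly \<Rightarrow> (nat \<Rightarrow> 'a) \<Rightarrow> 'a" where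
  "nc_eval scale f a =
     (\<Sum>w\<in>Poly_Mapping.keys f. scale (Poly_Mapping.lookup f w) (mult_list (map a w)))"

text \<open>
  Evaluating a nonzero constant term requires a unity.
\<close>

definition evaluable :: "'f::field nc_poly \<Rightarrow> 'a::ring itself \<Rightarrow> bool" where
  "evaluable f _ \<longleftrightarrow> Poly_Mapping.lookup f [] = 0 \<or> (\<exists>e :: 'a. is_unity e)"

text \<open>
  Only the values assigned to the finitely many variables that occur in \<open>f\<close> matter, so ranging
  over all assignments gives the set of all values \<open>f(a\<^sub>1,\<dots>,a\<^sub>n)\<close>.
\<close>

definition nc_image :: "('f::field \<Rightarrow> 'a::ring \<Rightarrow> 'a) \<Rightarrow> 'f nc_poly \<Rightarrow> 'a set" where
  "nc_image scale f = {nc_eval scale f a | a. True}"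

definition identity_of :: "('f::field \<Rightarrow> 'a::ring \<Rightarrow> 'a) \<Rightarrow> 'f nc_poly \<Rightarrow> bool" where
  "identity_of scale f \<longleftrightarrow> nc_image scale f = {0}"

definition central_polynomial_of :: "('f::field \<Rightarrow> 'a::ring \<Rightarrow> 'a) \<Rightarrow> 'f nc_poly \<Rightarrow> bool" where
  "central_polynomial_of scale f \<longleftrightarrow> nc_image scale f \<subseteq> center \<and> \<not> identity_of scale f"


section \<open>Tensor products\<close>

text \<open>
  The tensor product of \<open>S\<close> and \<open>B\<close> is the quotient of the vector space freely generated by
  the pairs \<open>(s, b)\<close> by the span of the bilinearity relations.  As this quotient depends on the
  scalar multiplications, it is not a HOL type in terms of \<open>'s\<close> and \<open>'b\<close>; instead we say that a
  given algebra, with a map \<open>t s b = s \<otimes> b\<close>, is (a copy of) this quotient: the linear extension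
  of \<open>t\<close> to the free vector space is onto and its kernel is the span of the relations.
\<close>

definition free_scale :: "'f::field \<Rightarrow> ('x \<Rightarrow>\<^sub>0 'f) \<Rightarrow> ('x \<Rightarrow>\<^sub>0 'f)" where
  "free_scale c p = Poly_Mapping.map ((*) c) p"

abbreviation gen :: "'x \<Rightarrow> ('x \<Rightarrow>\<^sub>0 'f::field)" where
  "gen x \<equiv> Poly_Mapping.single x 1"

definition tensor_relations ::
  "('f::field \<Rightarrow> 's::ab_group_add \<Rightarrow> 's) \<Rightarrow> ('f \<Rightarrow> 'b::ab_group_add \<Rightarrow> 'b) \<Rightarrow> ('s \<times> 'b \<Rightarrow>\<^sub>0 'f) set" where
  "tensor_relations scaleS scaleB =
     {gen (s + s', b) - gen (s, b) - gen (s', b) | s s' b. True} \<union>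
     {gen (s, b + b') - gen (s, b) - gen (s, b') | s b b'. True} \<union>
     {gen (scaleS c s, b) - free_scale c (gen (s, b)) | c s b. True} \<union>
     {gen (s, scaleB c b) - free_scale c (gen (s, b)) | c s b. True}"

definition linear_ext ::
  "('f::field \<Rightarrow> 'a::ab_group_add \<Rightarrow> 'a) \<Rightarrow> ('x \<Rightarrow> 'a) \<Rightarrow> ('x \<Rightarrow>\<^sub>0 'f) \<Rightarrow> 'a" where
  "linear_ext scale g p = (\<Sum>x\<in>Poly_Mapping.keys p. scale (Poly_Mapping.lookup p x) (g x))"

definition is_tensor_space ::
  "('f::field \<Rightarrow> 's::ab_group_add \<Rightarrow> 's) \<Rightarrow> ('f \<Rightarrow> 'b::ab_group_add \<Rightarrow> 'b) \<Rightarrow>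
   ('f \<Rightarrow> 'a::ab_group_add \<Rightarrow> 'a) \<Rightarrow> ('s \<Rightarrow> 'b \<Rightarrow> 'a) \<Rightarrow> bool" where
  "is_tensor_space scaleS scaleB scaleA t \<longleftrightarrow>
     surj (linear_ext scaleA (\<lambda>(s, b). t s b)) \<and>
     {p. linear_ext scaleA (\<lambda>(s, b). t s b) p = 0}
       = lspan free_scale (tensor_relations scaleS scaleB)"

definition is_tensor_algebra_product ::
  "('f::field \<Rightarrow> 's::ring \<Rightarrow> 's) \<Rightarrow> ('f \<Rightarrow> 'b::ring \<Rightarrow> 'b) \<Rightarrow>
   ('f \<Rightarrow> 'a::ring \<Rightarrow> 'a) \<Rightarrow> ('s \<Rightarrow> 'b \<Rightarrow> 'a) \<Rightarrow> bool" where
  "is_tensor_algebra_product scaleS scaleB scaleA t \<longleftrightarrow>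
     is_tensor_space scaleS scaleB scaleA t \<and>
     (\<forall>s s' b b'. t s b * t s' b' = t (s * s') (b * b'))"

lemma lookup_free_scale: "Poly_Mapping.lookup (free_scale c p) x = c * Poly_Mapping.lookup p x"
  by (simp add: free_scale_def Poly_Mapping.map.rep_eq when_def)

lemma vector_space_free: "vector_space free_scale"
  by unfold_locales
    (auto intro!: poly_mapping_eqI simp: lookup_free_scale lookup_add algebra_simps)

lemma linear_ext_superset:
  assumes "vector_space scale" "finite X" "Poly_Mapping.keys p \<subseteq> X"
  shows "linear_ext scale g p = (\<Sum>x\<in>X. scale (Poly_Mapping.lookup p x) (g x))"
proof -
  interpret vector_space scale by fact
  show ?thesis unfolding linear_ext_def
    by (rule sum.mono_neutral_left) (use assms in \<open>auto simp: in_keys_iff\<close>)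
qed

lemma linear_linear_ext:
  fixes scale :: "'f::field \<Rightarrow> 'a::ab_group_add \<Rightarrow> 'a" and g :: "'x \<Rightarrow> 'a"
  assumes "vector_space scale"
  shows "Vector_Spaces.linear free_scale scale (linear_ext scale g)"
proof -
  interpret F: vector_space free_scale by (rule vector_space_free)
  interpret V: vector_space scale by fact
  show ?thesis
  proof (unfold Vector_Spaces.linear_iff, intro conjI allI F.vector_space_axioms V.vector_space_axioms)
    fix p q :: "'x \<Rightarrow>\<^sub>0 'f"
    let ?X = "Poly_Mapping.keys p \<union> Poly_Mapping.keys q"
    have "Poly_Mapping.keys (p + q) \<subseteq> ?X" by (rule Poly_Mapping.keys_add)
    then show "linear_ext scale g (p + q) = linear_ext scale g p + linear_ext scale g q"
      by (simp add: linear_ext_superset[OF assms, where X = ?X] lookup_add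
          V.scale_left_distrib sum.distrib)
  next
    fix c and p :: "'x \<Rightarrow>\<^sub>0 'f"
    have "Poly_Mapping.keys (free_scale c p) \<subseteq> Poly_Mapping.keys p"
      by (auto simp: in_keys_iff lookup_free_scale)
    then show "linear_ext scale g (free_scale c p) = scale c (linear_ext scale g p)"
      by (simp add: linear_ext_superset[OF assms, where X = "Poly_Mapping.keys p"]
          lookup_free_scale V.scale_sum_right)
  qed
qed

lemma linear_ext_gen:
  assumes "vector_space scale"
  shows "linear_ext scale g (gen x) = g x"
proof -
  interpret vector_space scale by fact
  show ?thesis by (simp add: linear_ext_def)
qed

lemma linear_ext_relations:
  assumes "vector_space scaleW"
    and "\<And>b. Vector_Spaces.linear scaleS scaleW (\<lambda>s. \<beta> s b)"
    and "\<And>s. Vector_Spaces.linear scaleB scaleW (\<beta> s)"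
    and "p \<in> lspan free_scale (tensor_relations scaleS scaleB)"
  shows "linear_ext scaleW (\<lambda>(s, b). \<beta> s b) p = 0"
proof -
  interpret F: vector_space free_scale by (rule vector_space_free)
  interpret L: Vector_Spaces.linear free_scale scaleW "linear_ext scaleW (\<lambda>(s, b). \<beta> s b)"
    by (rule linear_linear_ext) fact
  interpret W: vector_space scaleW by fact
  note [simp] = linear_ext_gen[OF assms(1)]
  have l: "\<beta> (s + s') b = \<beta> s b + \<beta> s' b" "\<beta> (scaleS c s) b = scaleW c (\<beta> s b)" for s s' b c
  proof -
    interpret Vector_Spaces.linear scaleS scaleW "\<lambda>s. \<beta> s b" by fact
    show "\<beta> (s + s') b = \<beta> s b + \<beta> s' b" "\<beta> (scaleS c s) b = scaleW c (\<beta> s b)"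
      by (simp_all add: add scale)
  qed
  have r: "\<beta> s (b + b') = \<beta> s b + \<beta> s b'" "\<beta> s (scaleB c b) = scaleW c (\<beta> s b)" for s b b' c
  proof -
    interpret Vector_Spaces.linear scaleB scaleW "\<beta> s" by fact
    show "\<beta> s (b + b') = \<beta> s b + \<beta> s b'" "\<beta> s (scaleB c b) = scaleW c (\<beta> s b)"
      by (simp_all add: add scale)
  qed
  show ?thesis
  proof (rule L.eq_0_on_span[OF _ assms(4)])
    fix q assume "q \<in> tensor_relations scaleS scaleB"
    then show "linear_ext scaleW (\<lambda>(s, b). \<beta> s b) q = 0"
      by (auto simp: tensor_relations_def L.diff L.scale l r)
  qed
qed

text \<open>
  The universal property, for every target vector space.
\<close>

theorem tensor_universal_property:
  assumes S: "vector_space scaleS" and B: "vector_space scaleB" and A: "vector_space scaleA"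
    and W: "vector_space scaleW"
    and t: "is_tensor_space scaleS scaleB scaleA t"
    and bil: "\<And>b. Vector_Spaces.linear scaleS scaleW (\<lambda>s. \<beta> s b)"
      "\<And>s. Vector_Spaces.linear scaleB scaleW (\<beta> s)"
  shows "\<exists>!\<phi>. Vector_Spaces.linear scaleA scaleW \<phi> \<and> (\<forall>s b. \<phi> (t s b) = \<beta> s b)"
proof -
  let ?T = "linear_ext scaleA (\<lambda>(s, b). t s b)"
  let ?L = "linear_ext scaleW (\<lambda>(s, b). \<beta> s b)"
  interpret F: vector_space free_scale by (rule vector_space_free)
  interpret A: vector_space scaleA by fact
  interpret W: vector_space scaleW by fact
  interpret T: Vector_Spaces.linear free_scale scaleA ?T by (rule linear_linear_ext) fact
  interpret L: Vector_Spaces.linear free_scale scaleW ?L by (rule linear_linear_ext) fact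
  have surj: "surj ?T"
    and ker: "{p. ?T p = 0} = lspan free_scale (tensor_relations scaleS scaleB)"
    using t by (simp_all add: is_tensor_space_def)
  have wd: "?L p = ?L q" if "?T p = ?T q" for p q
  proof -
    have "p - q \<in> lspan free_scale (tensor_relations scaleS scaleB)"
      using that by (simp add: ker[symmetric] T.diff)
    then have "?L (p - q) = 0" by (rule linear_ext_relations[OF W bil])
    then show ?thesis by (simp add: L.diff)
  qed
  define \<phi> where "\<phi> x = ?L (inv ?T x)" for x
  have \<phi>T: "\<phi> (?T p) = ?L p" for p
    unfolding \<phi>_def by (rule wd) (simp add: surj_f_inv_f[OF surj])
  have lin: "Vector_Spaces.linear scaleA scaleW \<phi>"
  proof (unfold Vector_Spaces.linear_iff, intro conjI allI A.vector_space_axioms W.vector_space_axioms)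
    fix x y c
    obtain p q where "x = ?T p" "y = ?T q" using surj by (metis surjD)
    then show "\<phi> (x + y) = \<phi> x + \<phi> y" and "\<phi> (scaleA c x) = scaleW c (\<phi> x)"
      by (simp_all add: \<phi>T T.add[symmetric] T.scale[symmetric] L.add L.scale)
  qed
  have pure: "\<phi> (t s b) = \<beta> s b" for s b
    using \<phi>T[of "gen (s, b)"] by (simp add: linear_ext_gen A W)
  show ?thesis
  proof (rule ex1I[of _ \<phi>])
    show "Vector_Spaces.linear scaleA scaleW \<phi> \<and> (\<forall>s b. \<phi> (t s b) = \<beta> s b)"
      using lin pure by blast
  next
    fix \<psi> assume \<psi>: "Vector_Spaces.linear scaleA scaleW \<psi> \<and> (\<forall>s b. \<psi> (t s b) = \<beta> s b)"
    interpret P: Vector_Spaces.linear scaleA scaleW \<psi> using \<psi> by blast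
    show "\<psi> = \<phi>"
    proof
      fix x
      obtain p where p: "x = ?T p" using surj by (metis surjD)
      have "\<psi> (?T p) = ?L p"
        using \<psi> by (simp add: linear_ext_def P.sum P.scale case_prod_beta)
      then show "\<psi> x = \<phi> x" by (simp add: p \<phi>T)
    qed
  qed
qed

end

theory Submission
  imports Defs
begin

text \<open>
  Let \<open>U = span f(A)\<close>, and let \<open>M\<close> be the set of all \<open>s \<in> S\<close> with \<open>s \<otimes> B \<subseteq> U\<close>.  The
  proof shows that \<open>M\<close> is a nonzero two-sided ideal of \<open>S\<close>; by simplicity \<open>M = S\<close>, and hence
  \<open>U\<close> contains all pure tensors, which span \<open>A\<close>.

  Everything about \<open>f\<close> comes from one fact (\<open>coefficient_in_subspace\<close>): in characteristic 0, if
  a polynomial curve \<open>c \<mapsto> v\<^sub>0 + c v\<^sub>1 + c\<^sup>2 v\<^sub>2 + \<dots>\<close> stays inside a subspace, then so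
  do its coefficients.  This is used twice.

  Applied to \<open>c \<mapsto> f(a\<^sub>1 + c [a\<^sub>1, x], a\<^sub>2 + c [a\<^sub>2, x], \<dots>)\<close>, whose linear coefficient is
  \<open>[f(a\<^sub>1, a\<^sub>2, \<dots>), x]\<close> because \<open>[\<cdot>, x]\<close> is a derivation, it shows that \<open>U\<close> is a Lie ideal
  of \<open>A\<close> (\<open>commutator_span_nc_image\<close>).

  Applied to \<open>c \<mapsto> f(c a\<^sub>1, c a\<^sub>2, \<dots>)\<close>, it shows that \<open>U\<close> contains the values of every
  homogeneous component \<open>f\<^sub>k\<close> of \<open>f\<close>.  At \<open>a\<^sub>i = s\<^sub>i \<otimes> b\<close> such a value is
  \<open>f\<^sub>k(s\<^sub>1, s\<^sub>2, \<dots>) \<otimes> b\<^sup>k\<close> if \<open>k \<ge> 1\<close>, and since the \<open>k\<close>-th powers span \<open>B\<close>, all values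
  of \<open>f\<^sub>k\<close> on \<open>S\<close> lie in \<open>M\<close>.  They cannot all vanish, for then \<open>f\<close> would reduce on \<open>S\<close> to
  its constant term and have only central values.  So \<open>M \<noteq> 0\<close>.

  That \<open>M\<close> is an ideal (\<open>tensor_conductor_ideal\<close>) is where both hypotheses on \<open>B\<close> enter.  For
  \<open>s \<in> M\<close> and any \<open>r\<close>,
  \<open>[s \<otimes> b, r \<otimes> b'] = [s, r] \<otimes> bb' + rs \<otimes> [b, b']\<close> lies in \<open>U\<close>.
  Taking \<open>b' = b\<close> gives \<open>[s, r] \<otimes> b\<^sup>2 \<in> U\<close>, and squares span \<open>B\<close>, so \<open>[s, r] \<in> M\<close>.  Then
  the first summand always lies in \<open>U\<close>, hence so does \<open>rs \<otimes> [b, b']\<close>, and commutators span \<open>B\<close>, so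
  \<open>rs \<in> M\<close>.
\<close>

section \<open>Polynomial curves in a subspace\<close>

text \<open>
  If \<open>p(c) = v\<^sub>0 + c v\<^sub>1 + \<dots> + c\<^sup>n v\<^sub>n\<close>, then \<open>p(2c) - 2\<^sup>n p(c)\<close> has degree less than
  \<open>n\<close> and still takes values in the subspace; its coefficients are \<open>(2\<^sup>k - 2\<^sup>n) v\<^sub>k\<close>, and the
  factors for \<open>k < n\<close> are nonzero in characteristic 0.
\<close>

lemma coefficient_in_subspace:
  fixes scale :: "'f::field_char_0 \<Rightarrow> 'a::ab_group_add \<Rightarrow> 'a"
  assumes "vector_space scale" and U: "module.subspace scale U"
    and "\<And>c. (\<Sum>k<n. scale (c ^ k) (v k)) \<in> U" and "k < n"
  shows "v k \<in> U"
proof -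
  interpret vector_space scale by fact
  show ?thesis
    using assms(3,4)
  proof (induction n arbitrary: v k)
    case 0
    then show ?case by simp
  next
    case (Suc n)
    have lower: "v j \<in> U" if "j < n" for j
    proof -
      have "(\<Sum>i<n. scale (c ^ i) (scale (2 ^ i - 2 ^ n) (v i))) \<in> U" for c
      proof -
        have "(\<Sum>i<n. scale (c ^ i) (scale (2 ^ i - 2 ^ n) (v i)))
            = (\<Sum>i<Suc n. scale ((2 * c) ^ i) (v i)) - scale (2 ^ n) (\<Sum>i<Suc n. scale (c ^ i) (v i))"
          by (simp add: scale_sum_right scale_right_distrib power_mult_distrib
              sum_subtractf scale_left_diff_distrib scale_right_diff_distrib mult.commute)
        also have "\<dots> \<in> U" by (intro subspace_diff[OF U] subspace_scale[OF U] Suc.prems(1))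
        finally show ?thesis .
      qed
      then have "scale (2 ^ j - 2 ^ n) (v j) \<in> U"
        using Suc.IH[of "\<lambda>i. scale (2 ^ i - 2 ^ n) (v i)"] that by blast
      moreover have "(2::'f) ^ j - 2 ^ n \<noteq> 0"
      proof -
        have "(2::nat) ^ j \<noteq> 2 ^ n" using that by simp
        then have "of_nat (2 ^ j) \<noteq> (of_nat (2 ^ n) :: 'f)" by (simp only: of_nat_eq_iff) simp
        then show ?thesis by simp
      qed
      ultimately show ?thesis
        using subspace_scale[OF U, of "scale (2 ^ j - 2 ^ n) (v j)" "inverse (2 ^ j - 2 ^ n)"] by simp
    qed
    have "(\<Sum>i<Suc n. scale (1 ^ i) (v i)) - (\<Sum>i<n. v i) \<in> U"
      by (intro subspace_diff[OF U] subspace_sum[OF U] Suc.prems(1) lower) simp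
    then have "v n \<in> U" by simp
    with lower show ?case using Suc.prems(2) less_Suc_eq by blast
  qed
qed

text \<open>
  The coefficients \<open>q\<close> beyond the range of summation are required to vanish: this allows the
  range to be enlarged when two curves are added, and makes \<open>u\<close> and \<open>v\<close> the first two
  coefficients of \<open>p\<close> even if \<open>n < 2\<close>.
\<close>

definition polynomial_jet ::
  "('f::field \<Rightarrow> 'a::ab_group_add \<Rightarrow> 'a) \<Rightarrow> ('f \<Rightarrow> 'a) \<Rightarrow> 'a \<Rightarrow> 'a \<Rightarrow> bool" where
  "polynomial_jet scale p u v \<longleftrightarrow>
     (\<exists>n q. q 0 = u \<and> q 1 = v \<and> (\<forall>k\<ge>n. q k = 0) \<and> (\<forall>c. p c = (\<Sum>k<n. scale (c ^ k) (q k))))"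

lemma polynomial_jet_in_subspace:
  fixes scale :: "'f::field_char_0 \<Rightarrow> 'a::ab_group_add \<Rightarrow> 'a"
  assumes V: "vector_space scale" and U: "module.subspace scale U"
    and "polynomial_jet scale p u v" and "\<And>c. p c \<in> U"
  shows "v \<in> U"
proof -
  interpret vector_space scale by fact
  obtain n q where q: "q 1 = v" "\<forall>k\<ge>n. q k = 0" "\<And>c. p c = (\<Sum>k<n. scale (c ^ k) (q k))"
    using assms(3) unfolding polynomial_jet_def by blast
  show ?thesis
  proof (cases "1 < n")
    case True
    then show ?thesis
      using coefficient_in_subspace[OF V U, where v = q and n = n] q assms(4) by auto
  next
    case False
    then show ?thesis using q(1,2) subspace_0[OF U] by auto
  qed
qed

context assoc_algebra
begin

lemma polynomial_sum_extend:
  assumes "\<forall>k\<ge>n. q k = 0" and "n \<le> m"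
  shows "(\<Sum>k<n. scale (c ^ k) (q k)) = (\<Sum>k<m. scale (c ^ k) (q k))"
  by (rule sum.mono_neutral_left) (use assms in auto)

lemma polynomial_jet_affine: "polynomial_jet scale (\<lambda>c. u + scale c v) u v"
  unfolding polynomial_jet_def
  by (rule exI[of _ 2], rule exI[of _ "\<lambda>k. if k = 0 then u else if k = 1 then v else 0"])
    (auto simp: numeral_2_eq_2)

lemma polynomial_jet_const: "polynomial_jet scale (\<lambda>c. u) u 0"
  using polynomial_jet_affine[of u 0] by simp

lemma polynomial_jet_add:
  assumes "polynomial_jet scale p u v" and "polynomial_jet scale p' u' v'"
  shows "polynomial_jet scale (\<lambda>c. p c + p' c) (u + u') (v + v')"
proof -
  obtain n q where q: "q 0 = u" "q 1 = v" "\<forall>k\<ge>n. q k = 0" "\<And>c. p c = (\<Sum>k<n. scale (c ^ k) (q k))"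
    using assms(1) unfolding polynomial_jet_def by blast
  obtain n' q' where q': "q' 0 = u'" "q' 1 = v'" "\<forall>k\<ge>n'. q' k = 0"
      "\<And>c. p' c = (\<Sum>k<n'. scale (c ^ k) (q' k))"
    using assms(2) unfolding polynomial_jet_def by blast
  let ?m = "max n n'"
  have "p c + p' c = (\<Sum>k<?m. scale (c ^ k) (q k + q' k))" for c
    using polynomial_sum_extend[OF q(3), of ?m c] polynomial_sum_extend[OF q'(3), of ?m c]
    by (simp add: q(4) q'(4) scale_right_distrib sum.distrib)
  then show ?thesis
    unfolding polynomial_jet_def using q q'
    by (intro exI[of _ ?m] exI[of _ "\<lambda>k. q k + q' k"]) simp
qed

lemma polynomial_jet_scale:
  assumes "polynomial_jet scale p u v"
  shows "polynomial_jet scale (\<lambda>c. scale e (p c)) (scale e u) (scale e v)"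
proof -
  obtain n q where q: "q 0 = u" "q 1 = v" "\<forall>k\<ge>n. q k = 0" "\<And>c. p c = (\<Sum>k<n. scale (c ^ k) (q k))"
    using assms unfolding polynomial_jet_def by blast
  show ?thesis
    unfolding polynomial_jet_def using q
    by (intro exI[of _ n] exI[of _ "\<lambda>k. scale e (q k)"]) (simp add: scale_sum_right mult.commute)
qed

lemma polynomial_jet_sum:
  assumes "\<And>x. x \<in> X \<Longrightarrow> polynomial_jet scale (p x) (u x) (v x)"
  shows "polynomial_jet scale (\<lambda>c. \<Sum>x\<in>X. p x c) (\<Sum>x\<in>X. u x) (\<Sum>x\<in>X. v x)"
  using assms
  by (induction X rule: infinite_finite_induct)
    (simp_all add: polynomial_jet_const polynomial_jet_add)

lemma polynomial_jet_affine_mult: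
  assumes "polynomial_jet scale p u v"
  shows "polynomial_jet scale (\<lambda>c. (u' + scale c v') * p c) (u' * u) (u' * v + v' * u)"
proof -
  obtain n q where q: "q 0 = u" "q 1 = v" "\<forall>k\<ge>n. q k = 0" "\<And>c. p c = (\<Sum>k<n. scale (c ^ k) (q k))"
    using assms unfolding polynomial_jet_def by blast
  define r where "r k = u' * q k + (case k of 0 \<Rightarrow> 0 | Suc j \<Rightarrow> v' * q j)" for k
  have "(u' + scale c v') * p c = (\<Sum>k<Suc n. scale (c ^ k) (r k))" for c
  proof -
    have "(\<Sum>k<Suc n. scale (c ^ k) (r k))
        = u' * (\<Sum>k<Suc n. scale (c ^ k) (q k))
          + (\<Sum>k<Suc n. scale (c ^ k) (case k of 0 \<Rightarrow> 0 | Suc j \<Rightarrow> v' * q j))"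
      by (simp add: r_def scale_right_distrib sum.distrib sum_distrib_left scale_mult_right
          distrib_left del: sum.lessThan_Suc)
    also have "(\<Sum>k<Suc n. scale (c ^ k) (q k)) = p c"
      using polynomial_sum_extend[OF q(3), of "Suc n" c] q(4) by simp
    also have "(\<Sum>k<Suc n. scale (c ^ k) (case k of 0 \<Rightarrow> 0 | Suc j \<Rightarrow> v' * q j)) = scale c v' * p c"
      by (simp add: sum.lessThan_Suc_shift q(4) sum_distrib_left scale_mult_left scale_mult_right
          scale_sum_right mult.commute del: sum.lessThan_Suc)
    finally show ?thesis by (simp add: distrib_right)
  qed
  moreover have "r 0 = u' * u" "r 1 = u' * v + v' * u" using q by (simp_all add: r_def)
  moreover have "\<forall>k\<ge>Suc n. r k = 0" using q(3) by (auto simp: r_def split: nat.split)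
  ultimately show ?thesis unfolding polynomial_jet_def by blast
qed


section \<open>The span of the image of a polynomial\<close>

lemma is_unity_mult_list_Nil:
  assumes "is_unity (e :: 'a)"
  shows "is_unity (mult_list [] :: 'a)"
proof -
  have "(THE e. is_unity e) = e"
    using assms by (intro the_equality) (auto simp: is_unity_def, metis)
  with assms show ?thesis by simp
qed

lemma constant_term_central:
  assumes "evaluable f TYPE('a)"
  shows "scale (Poly_Mapping.lookup f []) (mult_list [] :: 'a) \<in> center"
proof -
  have "is_unity (mult_list [] :: 'a)" if "Poly_Mapping.lookup f [] \<noteq> 0"
    using assms that is_unity_mult_list_Nil by (auto simp: evaluable_def)
  then show ?thesis
    by (cases "Poly_Mapping.lookup f [] = 0")
      (simp_all add: center_def scale_mult_left scale_mult_right is_unity_def)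
qed

text \<open>
  The linear coefficient obeys the product rule, as does the derivation \<open>[\<cdot>, x]\<close>, and the two agree
  on words of length 1.
\<close>

lemma polynomial_jet_mult_list:
  assumes "w \<noteq> []"
  shows "polynomial_jet scale (\<lambda>c. mult_list (map (\<lambda>i. a i + scale c (commutator (a i) x)) w))
    (mult_list (map a w)) (commutator (mult_list (map a w)) x)"
  using assms
proof (induction w rule: induct_list012)
  case 1
  then show ?case by simp
next
  case (2 i)
  show ?case by (simp add: polynomial_jet_affine)
next
  case (3 i j w)
  have leibniz: "commutator (y * z) x = y * commutator z x + commutator y x * z" for y z
    by (simp add: commutator_def algebra_simps)
  from 3(2) polynomial_jet_affine_mult show ?case by (simp add: leibniz)
qed

lemma polynomial_jet_nc_eval:
  fixes a :: "nat \<Rightarrow> 'a"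
  assumes "evaluable f TYPE('a)"
  shows "polynomial_jet scale (\<lambda>c. nc_eval scale f (\<lambda>i. a i + scale c (commutator (a i) x)))
    (nc_eval scale f a) (commutator (nc_eval scale f a) x)"
proof -
  let ?term = "\<lambda>w c. scale (Poly_Mapping.lookup f w)
    (mult_list (map (\<lambda>i. a i + scale c (commutator (a i) x)) w))"
  let ?val = "\<lambda>w. scale (Poly_Mapping.lookup f w) (mult_list (map a w))"
  have scale_commutator: "scale e (commutator y x) = commutator (scale e y) x" for e y
    by (simp add: commutator_def scale_mult_left scale_mult_right scale_right_diff_distrib)
  have "polynomial_jet scale (?term w) (?val w) (commutator (?val w) x)" for w
  proof (cases "w = []")
    case True
    have "commutator (?val []) x = 0"
      using constant_term_central[OF assms] by (simp add: commutator_def center_def)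
    then show ?thesis using True polynomial_jet_const by simp
  next
    case False
    from polynomial_jet_scale[OF polynomial_jet_mult_list[OF False]]
    show ?thesis unfolding scale_commutator[of "Poly_Mapping.lookup f w", symmetric] .
  qed
  then have "polynomial_jet scale (\<lambda>c. \<Sum>w\<in>Poly_Mapping.keys f. ?term w c)
      (\<Sum>w\<in>Poly_Mapping.keys f. ?val w) (\<Sum>w\<in>Poly_Mapping.keys f. commutator (?val w) x)"
    by (rule polynomial_jet_sum)
  moreover have "(\<Sum>w\<in>Poly_Mapping.keys f. commutator (?val w) x) = commutator (nc_eval scale f a) x"
    by (simp add: nc_eval_def commutator_def sum_subtractf sum_distrib_left sum_distrib_right)
  ultimately show ?thesis by (simp add: nc_eval_def)
qed

definition homogeneous_eval :: "'f nc_poly \<Rightarrow> nat \<Rightarrow> (nat \<Rightarrow> 'a) \<Rightarrow> 'a" where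
  "homogeneous_eval f k a =
     (\<Sum>w | w \<in> Poly_Mapping.keys f \<and> length w = k.
        scale (Poly_Mapping.lookup f w) (mult_list (map a w)))"

lemma nc_eval_eq_sum_homogeneous:
  obtains n where "\<And>a. nc_eval scale f a = (\<Sum>k<n. homogeneous_eval f k a)"
    and "\<And>k a. n \<le> k \<Longrightarrow> homogeneous_eval f k a = 0"
proof -
  define n where "n = Suc (Max (insert 0 (length ` Poly_Mapping.keys f)))"
  have n: "length w < n" if "w \<in> Poly_Mapping.keys f" for w
    unfolding n_def less_Suc_eq_le by (rule Max_ge) (use that in auto)
  show thesis
  proof (rule that[of n])
    fix a
    show "nc_eval scale f a = (\<Sum>k<n. homogeneous_eval f k a)"
      unfolding nc_eval_def homogeneous_eval_def
      using sum.group[of "Poly_Mapping.keys f" "{..<n}" length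
          "\<lambda>w. scale (Poly_Mapping.lookup f w) (mult_list (map a w))"] n
      by (auto simp: image_subset_iff)
  next
    fix k a
    assume "n \<le> k"
    then have "{w \<in> Poly_Mapping.keys f. length w = k} = {}" using n by fastforce
    then show "homogeneous_eval f k a = 0" by (simp only: homogeneous_eval_def sum.empty)
  qed
qed

lemma mult_list_scale: "mult_list (map (\<lambda>i. scale c (a i)) w) = scale (c ^ length w) (mult_list (map a w))"
  by (induction w rule: induct_list012) (simp_all add: scale_mult_left scale_mult_right)

lemma homogeneous_eval_scale:
  "homogeneous_eval f k (\<lambda>i. scale c (a i)) = scale (c ^ k) (homogeneous_eval f k a)"
  unfolding homogeneous_eval_def scale_sum_right
  by (rule sum.cong) (auto simp: mult_list_scale mult.commute)

lemma homogeneous_eval_0: "homogeneous_eval f 0 a = scale (Poly_Mapping.lookup f []) (mult_list [])"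
proof -
  have "{w \<in> Poly_Mapping.keys f. length w = 0} = (if [] \<in> Poly_Mapping.keys f then {[]} else {})"
    by auto
  then show ?thesis
    unfolding homogeneous_eval_def by (simp add: in_keys_iff del: length_0_conv)
qed

text \<open>
  If all components of positive degree vanish at \<open>a\<close>, the value at \<open>a\<close> is the constant term,
  which is zero or a multiple of the unity, and so is central.
\<close>

lemma noncentral_value_imp_homogeneous_value:
  fixes a :: "nat \<Rightarrow> 'a"
  assumes "evaluable f TYPE('a)" and "nc_eval scale f a \<notin> center"
  obtains k where "k \<ge> 1" and "homogeneous_eval f k a \<noteq> 0"
proof -
  have False if *: "\<And>k. k \<ge> 1 \<Longrightarrow> homogeneous_eval f k a = 0"
  proof -
    obtain n where n: "\<And>a. nc_eval scale f a = (\<Sum>k<n. homogeneous_eval f k a)"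
        "\<And>k a. n \<le> k \<Longrightarrow> homogeneous_eval f k a = 0"
      using nc_eval_eq_sum_homogeneous[of f] by blast
    have "nc_eval scale f a = (\<Sum>k<Suc n. homogeneous_eval f k a)" by (simp add: n)
    also have "\<dots> = homogeneous_eval f 0 a" using * by (simp add: sum.lessThan_Suc_shift del: sum.lessThan_Suc)
    finally have "nc_eval scale f a \<in> center"
      using constant_term_central[OF assms(1)] by (simp add: homogeneous_eval_0)
    with assms(2) show False by blast
  qed
  then show thesis using that by blast
qed

end

text \<open>
  The span is a Lie ideal: moving all arguments \<open>a\<^sub>i\<close> at once in the directions \<open>[a\<^sub>i, x]\<close>
  gives a curve of values of \<open>f\<close> with linear coefficient \<open>[f(a), x]\<close>.
\<close>

lemma commutator_span_nc_image:
  fixes scale :: "'f::field_char_0 \<Rightarrow> 'a::ring \<Rightarrow> 'a"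
  assumes "assoc_algebra scale" and ev: "evaluable f TYPE('a)" and y: "y \<in> lspan scale (nc_image scale f)"
  shows "commutator y x \<in> lspan scale (nc_image scale f)"
proof -
  interpret assoc_algebra scale by fact
  let ?U = "span (nc_image scale f)"
  show ?thesis
    using y
  proof (induction rule: span_induct_alt)
    case base
    show ?case by (simp add: commutator_def span_zero)
  next
    case (step c z y)
    then obtain a where a: "z = nc_eval scale f a" by (auto simp: nc_image_def)
    have "commutator z x \<in> ?U"
      unfolding a
      by (rule polynomial_jet_in_subspace[OF vector_space_axioms subspace_span polynomial_jet_nc_eval[OF ev]])
        (auto simp: nc_image_def intro: span_base)
    then have "scale c (commutator z x) + commutator y x \<in> ?U"
      using step by (intro span_add span_scale)
    moreover have "scale c (commutator z x) + commutator y x = commutator (scale c z + y) x"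
      by (simp add: commutator_def scale_mult_left scale_mult_right scale_right_diff_distrib algebra_simps)
    ultimately show ?case by simp
  qed
qed

text \<open>
  Scaling all arguments by \<open>c\<close> gives a curve of values of \<open>f\<close> whose coefficients are the values of
  the homogeneous components.
\<close>

lemma homogeneous_eval_in_span_nc_image:
  fixes scale :: "'f::field_char_0 \<Rightarrow> 'a::ring \<Rightarrow> 'a"
  assumes "assoc_algebra scale"
  shows "assoc_algebra.homogeneous_eval scale f k a \<in> lspan scale (nc_image scale f)"
proof -
  interpret assoc_algebra scale by fact
  let ?U = "span (nc_image scale f)"
  obtain n where n: "\<And>a. nc_eval scale f a = (\<Sum>k<n. homogeneous_eval f k a)"
      "\<And>k a. n \<le> k \<Longrightarrow> homogeneous_eval f k a = 0"
    using nc_eval_eq_sum_homogeneous[of f] by blast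
  have "(\<Sum>k<n. scale (c ^ k) (homogeneous_eval f k a)) \<in> ?U" for c
  proof -
    have "nc_eval scale f (\<lambda>i. scale c (a i)) \<in> ?U" by (auto simp: nc_image_def intro: span_base)
    then show ?thesis by (simp add: n(1) homogeneous_eval_scale)
  qed
  from coefficient_in_subspace[OF vector_space_axioms subspace_span this]
  show ?thesis using n(2)[of k a] span_zero by (cases "k < n") auto
qed


section \<open>Tensor products of algebras\<close>

text \<open>
  The bilinearity relations lie in the kernel of the linear extension of \<open>t\<close>, so \<open>t\<close> is bilinear.
\<close>

lemma tensor_bilinear:
  assumes A: "vector_space scaleA" and "is_tensor_space scaleS scaleB scaleA t"
  shows "t (s + s') b = t s b + t s' b" and "t s (b + b') = t s b + t s b'"
    and "t (scaleS c s) b = scaleA c (t s b)" and "t s (scaleB c b) = scaleA c (t s b)"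
proof -
  interpret F: vector_space free_scale by (rule vector_space_free)
  interpret L: Vector_Spaces.linear free_scale scaleA "linear_ext scaleA (\<lambda>(s, b). t s b)"
    by (rule linear_linear_ext) fact
  have "linear_ext scaleA (\<lambda>(s, b). t s b) p = 0" if "p \<in> tensor_relations scaleS scaleB" for p
    using assms(2) F.span_base[OF that] unfolding is_tensor_space_def by blast
  note rel = this[unfolded tensor_relations_def]
  have "linear_ext scaleA (\<lambda>(s, b). t s b) (gen (s + s', b) - gen (s, b) - gen (s', b)) = 0"
    "linear_ext scaleA (\<lambda>(s, b). t s b) (gen (s, b + b') - gen (s, b) - gen (s, b')) = 0"
    "linear_ext scaleA (\<lambda>(s, b). t s b) (gen (scaleS c s, b) - free_scale c (gen (s, b))) = 0"
    "linear_ext scaleA (\<lambda>(s, b). t s b) (gen (s, scaleB c b) - free_scale c (gen (s, b))) = 0"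
    by (rule rel; blast)+
  then show "t (s + s') b = t s b + t s' b" "t s (b + b') = t s b + t s b'"
    "t (scaleS c s) b = scaleA c (t s b)" "t s (scaleB c b) = scaleA c (t s b)"
    by (simp_all add: L.add L.diff L.scale linear_ext_gen[OF A] diff_diff_eq)
qed

lemma subspace_contains_pure_tensors:
  assumes A: "vector_space scaleA" and "is_tensor_space scaleS scaleB scaleA t"
    and U: "module.subspace scaleA U" and pure: "\<And>s b. t s b \<in> U"
  shows "U = UNIV"
proof -
  interpret A: vector_space scaleA by fact
  have "x \<in> U" for x
  proof -
    obtain p where "x = linear_ext scaleA (\<lambda>(s, b). t s b) p"
      using assms(2) unfolding is_tensor_space_def by (metis surjD)
    then show ?thesis
      unfolding linear_ext_def using pure
      by (auto intro!: A.subspace_sum[OF U] A.subspace_scale[OF U])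
  qed
  then show ?thesis by blast
qed

locale algebra_tensor_product =
  S: assoc_algebra scaleS + B: assoc_algebra scaleB + A: assoc_algebra scaleA
  for scaleS :: "'f::field_char_0 \<Rightarrow> 's::ring \<Rightarrow> 's"
    and scaleB :: "'f \<Rightarrow> 'b::ring \<Rightarrow> 'b"
    and scaleA :: "'f \<Rightarrow> 'a::ring \<Rightarrow> 'a" +
  fixes tensor :: "'s \<Rightarrow> 'b \<Rightarrow> 'a"
  assumes tensor_product: "is_tensor_algebra_product scaleS scaleB scaleA tensor"
begin

lemma tensor_space: "is_tensor_space scaleS scaleB scaleA tensor"
  and tensor_mult: "tensor s b * tensor s' b' = tensor (s * s') (b * b')"
  using tensor_product by (simp_all add: is_tensor_algebra_product_def)

lemmas bilinear = tensor_bilinear[OF A.vector_space_axioms tensor_space]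

sublocale left: Vector_Spaces.linear scaleS scaleA "\<lambda>s. tensor s b" for b
  by (simp add: Vector_Spaces.linear_iff S.vector_space_axioms A.vector_space_axioms bilinear)

sublocale right: Vector_Spaces.linear scaleB scaleA "tensor s" for s
  by (simp add: Vector_Spaces.linear_iff B.vector_space_axioms A.vector_space_axioms bilinear)

text \<open>
  The analogue of an ideal quotient \<open>U : B\<close>, with the tensor product in the role of the product.
\<close>

definition conductor :: "'a set \<Rightarrow> 's set" where
  "conductor U = {s. \<forall>b. tensor s b \<in> U}"

lemma subspace_conductor:
  assumes "A.subspace U"
  shows "S.subspace (conductor U)"
  unfolding S.subspace_def conductor_def
  using A.subspace_add[OF assms] A.subspace_scale[OF assms] A.subspace_0[OF assms]
  by (auto simp: left.add left.scale left.zero)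

lemma mem_conductorI:
  assumes U: "A.subspace U" and span: "B.span X = UNIV" and X: "\<And>b. b \<in> X \<Longrightarrow> tensor s b \<in> U"
  shows "s \<in> conductor U"
proof -
  have "tensor s b \<in> U" for b
  proof -
    have "b \<in> B.span X" using span by simp
    then show ?thesis
      by (induction rule: B.span_induct_alt)
        (auto simp: right.zero right.add right.scale
          intro: A.subspace_0[OF U] A.subspace_add[OF U] A.subspace_scale[OF U] X)
  qed
  then show ?thesis by (simp add: conductor_def)
qed

text \<open>
  From \<open>[s \<otimes> b, r \<otimes> b'] = [s, r] \<otimes> bb' + rs \<otimes> [b, b']\<close>: the case \<open>b = b'\<close> puts \<open>[s, r]\<close> into
  the conductor, and then the general case puts \<open>rs\<close> there.
\<close>

lemma tensor_conductor_ideal: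
  assumes U: "A.subspace U" and lie: "\<And>y x. y \<in> U \<Longrightarrow> commutator y x \<in> U"
    and squares: "B.span {b * b | b. True} = UNIV"
    and commutators: "B.span {commutator b b' | b b'. True} = UNIV"
  shows "two_sided_ideal scaleS (conductor U)"
proof -
  have sub: "S.subspace (conductor U)" using U by (rule subspace_conductor)
  have ideal: "r * s \<in> conductor U \<and> s * r \<in> conductor U" if s: "s \<in> conductor U" for s r
  proof -
    have eq: "commutator (tensor s b) (tensor r b')
        = tensor (commutator s r) (b * b') + tensor (r * s) (commutator b b')" for b b'
      by (simp add: commutator_def tensor_mult left.diff right.diff)
    have mem: "tensor (commutator s r) (b * b') + tensor (r * s) (commutator b b') \<in> U" for b b'
      using lie[of "tensor s b" "tensor r b'"] s by (simp add: eq conductor_def)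
    have comm: "commutator s r \<in> conductor U"
    proof (rule mem_conductorI[OF U squares])
      fix x :: 'b assume "x \<in> {b * b | b. True}"
      then obtain b where "x = b * b" by blast
      then show "tensor (commutator s r) x \<in> U"
        using mem[of b b] by (simp add: commutator_def[of b b] right.zero)
    qed
    have rs: "r * s \<in> conductor U"
    proof (rule mem_conductorI[OF U commutators])
      fix x :: 'b assume "x \<in> {commutator b b' | b b'. True}"
      then obtain b b' where x: "x = commutator b b'" by blast
      show "tensor (r * s) x \<in> U"
        using A.subspace_diff[OF U mem[of b b'], of "tensor (commutator s r) (b * b')"] comm x
        by (simp add: conductor_def)
    qed
    have "s * r = commutator s r + r * s" by (simp add: commutator_def)
    with comm rs show ?thesis using S.subspace_add[OF sub] by simp
  qed
  then show ?thesis using sub by (auto simp: two_sided_ideal_def)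
qed

lemma mult_list_tensor:
  assumes "w \<noteq> []"
  shows "mult_list (map (\<lambda>i. tensor (s i) b) w) = tensor (mult_list (map s w)) (power_of b (length w))"
  using assms
  by (induction w rule: induct_list012) (simp_all add: power_of_def tensor_mult)

lemma homogeneous_eval_tensor:
  assumes "k \<ge> 1"
  shows "A.homogeneous_eval f k (\<lambda>i. tensor (s i) b) = tensor (S.homogeneous_eval f k s) (power_of b k)"
proof -
  have "scaleA (Poly_Mapping.lookup f w) (mult_list (map (\<lambda>i. tensor (s i) b) w))
      = tensor (scaleS (Poly_Mapping.lookup f w) (mult_list (map s w))) (power_of b k)"
    if "length w = k" for w
  proof -
    have "w \<noteq> []" using that assms by auto
    then show ?thesis by (simp add: mult_list_tensor left.scale that)
  qed
  then show ?thesis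
    by (simp add: A.homogeneous_eval_def S.homogeneous_eval_def left.sum)
qed

lemma homogeneous_value_in_conductor:
  assumes "k \<ge> 1" and "B.span {power_of b k | b. True} = UNIV"
  shows "S.homogeneous_eval f k s \<in> conductor (A.span (nc_image scaleA f))"
proof (rule mem_conductorI[OF A.subspace_span assms(2)])
  fix x :: 'b assume "x \<in> {power_of b k | b. True}"
  then show "tensor (S.homogeneous_eval f k s) x \<in> A.span (nc_image scaleA f)"
    using homogeneous_eval_in_span_nc_image[OF A.assoc_algebra_axioms]
    by (auto simp: homogeneous_eval_tensor[OF assms(1), symmetric])
qed

end


section \<open>Polynomials with a noncentral value\<close>

theorem theorem2p4:
  fixes scaleS :: "'f::field_char_0 \<Rightarrow> 's::ring \<Rightarrow> 's"
    and scaleB :: "'f \<Rightarrow> 'b::ring \<Rightarrow> 'b"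
    and scaleA :: "'f \<Rightarrow> 'a::ring \<Rightarrow> 'a"
    and tensor :: "'s \<Rightarrow> 'b \<Rightarrow> 'a"
    and f :: "'f nc_poly"
  assumes "assoc_algebra scaleS" and "assoc_algebra scaleB" and "assoc_algebra scaleA"
    and "is_tensor_algebra_product scaleS scaleB scaleA tensor"
    and "simple_algebra scaleS"
    and "\<And>x :: 'b. \<exists>ps :: ('b \<times> 'b) list. x = (\<Sum>(u, v)\<leftarrow>ps. commutator u v)"
    and "\<And>(n :: nat) (x :: 'b). n \<ge> 1 \<Longrightarrow> x \<in> lspan scaleB {power_of b n | b. True}"
    and "evaluable f TYPE('s)" and "evaluable f TYPE('a)"
    and "\<not> identity_of scaleS f" and "\<not> central_polynomial_of scaleS f"
  shows "lspan scaleA (nc_image scaleA f) = UNIV"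
proof -
  interpret algebra_tensor_product scaleS scaleB scaleA tensor
    using assms(1-4) by (simp add: algebra_tensor_product_def algebra_tensor_product_axioms_def)
  let ?U = "A.span (nc_image scaleA f)"
  have powers: "B.span {power_of b n | b. True} = UNIV" if "n \<ge> 1" for n
    using assms(7)[OF that] by blast
  have squares: "B.span {b * b | b. True} = UNIV"
    using powers[of 2] by (simp add: power_of_def numeral_2_eq_2)
  have commutators: "B.span {commutator b b' | b b'. True} = UNIV"
  proof -
    have "(\<Sum>(u, v)\<leftarrow>ps. commutator u v) \<in> B.span {commutator b b' | b b'. True}" for ps :: "('b \<times> 'b) list"
      by (induction ps) (auto simp: B.span_zero intro!: B.span_add intro: B.span_base)
    then show ?thesis using assms(6) by (metis UNIV_eq_I)
  qed
  have "two_sided_ideal scaleS (conductor ?U)"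
    using commutator_span_nc_image[OF assms(3,9)] A.subspace_span squares commutators
    by (intro tensor_conductor_ideal)
  then have "conductor ?U = {0} \<or> conductor ?U = UNIV"
    using assms(5) by (simp add: simple_algebra_def)
  moreover have "conductor ?U \<noteq> {0}"
  proof -
    obtain a where "nc_eval scaleS f a \<notin> center"
      using assms(10,11) by (auto simp: central_polynomial_of_def nc_image_def)
    then obtain k where "k \<ge> 1" "S.homogeneous_eval f k a \<noteq> 0"
      using S.noncentral_value_imp_homogeneous_value[OF assms(8)] by blast
    then show ?thesis using homogeneous_value_in_conductor[OF _ powers] by blast
  qed
  ultimately have "tensor s b \<in> ?U" for s b by (auto simp: conductor_def)
  then show ?thesis
    by (rule subspace_contains_pure_tensors[OF A.vector_space_axioms tensor_space A.subspace_span])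
qed

end
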